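(* Let $a\in\mathbb{R}$ and let $TI$ be a topological index of one of the two forms $TI(G)=\sum_{v\in V(G)}h(d_v)^a$ with $h:\{1,2,\dots\}\to(0,\infty)$, or $TI(G)=\sum_{uv\in E(G)}f(d_u,d_v)^a$ with $f:\{1,2,\dots\}\times\{1,2,\dots\}\to(0,\infty)$ symmetric. Let $RSC_n=RSC(n,p_1,p_2,p_3)$ be a random spiro chain and $TI_n=TI(RSC_n)$ for $n\ge2$. For $i=1,2,3$ put $\alpha_i=TI(RSC_3^i)-TI_2$, and let $\alpha=\sum_{i=1}^3\alpha_ip_i$ and $\beta=\sum_{i=1}^3\alpha_i^2p_i$. Assume $\beta-\alpha^2>0$. Then, as $n\to\infty$, $$\frac{TI_n-(n-2)\alpha}{\sqrt{n}}\xrightarrow{D}N(0,\beta-\alpha^2),$$ where $\xrightarrow{D}$ denotes convergence in distribution and $N(\mu,\sigma^2)$ is the normal distribution with mean $\mu$ and variance $\sigma^2$.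
   Context: For a finite simple graph $G$, $V(G)$ and $E(G)$ are its vertex and edge sets and $d_v$ is the degree of the vertex $v$. Random spiro chain. Fix $p_1,p_2,p_3$ with $0<p_i<1$ and $p_1+p_2+p_3=1$. The random spiro chain $RSC_n=RSC(n,p_1,p_2,p_3)$ with $n$ hexagons is built as follows. $RSC_1$ is a hexagon $H_1$ (a 6-cycle). $RSC_2$ consists of two hexagons $H_1,H_2$ sharing exactly one vertex. For $n>2$, $RSC_n$ is obtained from $RSC_{n-1}$ by attaching a new hexagon $H_n$ to the last hexagon $H_{n-1}$, identifying one vertex of $H_n$ with a vertex $w$ of $H_{n-1}$, where $w$ is at distance $i\in\{1,2,3\}$ (in the 6-cycle $H_{n-1}$) from the vertex that $H_{n-1}$ shares with $H_{n-2}$. The resulting graph is denoted $RSC_n^i$. Case $i$ is chosen with probability $p_i$, independently of the previous choices; $L_n\in\{1,2,3\}$ denotes the choice made at step $n$, so $\mathbb{P}(L_n=i)=p_i$. The graph $RSC_2$ and the graphs $RSC_3^1,RSC_3^2,RSC_3^3$ are deterministic (up to isomorphism), so $TI_2$ and $TI(RSC_3^i)$ are constants. *)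

theory Defs
  imports "HOL-Probability.Probability"
begin

type_synonym 'v graph = "'v set \<times> 'v set set"

abbreviation gverts :: "'v graph \<Rightarrow> 'v set" where "gverts G \<equiv> fst G"

abbreviation gedges :: "'v graph \<Rightarrow> 'v set set" where "gedges G \<equiv> snd G"

definition gunion :: "'v graph \<Rightarrow> 'v graph \<Rightarrow> 'v graph" where
  "gunion G H = (gverts G \<union> gverts H, gedges G \<union> gedges H)"

definition gdegree :: "'v graph \<Rightarrow> 'v \<Rightarrow> nat" where
  "gdegree G v = card {e \<in> gedges G. v \<in> e}"

text \<open>The length of a shortest walk; only meaningful for vertices in the same component.\<close>

definition gdist :: "'v graph \<Rightarrow> 'v \<Rightarrow> 'v \<Rightarrow> nat" where
  "gdist G u v = (LEAST k. (u, v) \<in> {(x, y). {x, y} \<in> gedges G} ^^ k)"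

definition vertex_index :: "(nat \<Rightarrow> real) \<Rightarrow> real \<Rightarrow> 'v graph \<Rightarrow> real" where
  "vertex_index h a G = (\<Sum>v\<in>gverts G. h (gdegree G v) powr a)"

text \<open>The \<open>THE\<close> reads off the summand of an unordered edge; it is well defined when \<open>f\<close> is
  symmetric on the degrees that occur.\<close>

definition edge_index :: "(nat \<Rightarrow> nat \<Rightarrow> real) \<Rightarrow> real \<Rightarrow> 'v graph \<Rightarrow> real" where
  "edge_index f a G =
     (\<Sum>e\<in>gedges G. THE c. \<exists>u v. e = {u, v} \<and> c = f (gdegree G u) (gdegree G v) powr a)"

definition topological_index :: "real \<Rightarrow> ('v graph \<Rightarrow> real) \<Rightarrow> bool" where
  "topological_index a TI \<longleftrightarrow>
     (\<exists>h. (\<forall>k\<ge>1. 0 < h k) \<and> TI = vertex_index h a) \<or>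
     (\<exists>f. (\<forall>k\<ge>1. \<forall>l\<ge>1. 0 < f k l \<and> f k l = f l k) \<and> TI = edge_index f a)"

definition cycle_graph :: "'v list \<Rightarrow> 'v graph" where
  "cycle_graph vs = (set vs, {{vs ! k, vs ! (Suc k mod length vs)} | k. k < length vs})"

definition hexagon :: "'v graph \<Rightarrow> bool" where
  "hexagon H \<longleftrightarrow> (\<exists>vs. length vs = 6 \<and> distinct vs \<and> H = cycle_graph vs)"

text \<open>In \<open>spiro_build ls G H s\<close>, \<open>G\<close> is a spiro chain with \<open>length ls + 2\<close> hexagons obtained by the
  successive choices \<open>ls\<close> (starting with the choice for the third hexagon), \<open>H\<close> is its last hexagon,
  and \<open>s\<close> is the vertex that \<open>H\<close> shares with the hexagon before it. Identifying a vertex of the new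
  hexagon with \<open>w\<close> is expressed by the vertex sets meeting exactly in \<open>w\<close>. For a given distance 1 or 2
  there are two candidates for \<open>w\<close>, both of which are allowed; the resulting graphs are isomorphic.\<close>

inductive spiro_build :: "nat list \<Rightarrow> 'v graph \<Rightarrow> 'v graph \<Rightarrow> 'v \<Rightarrow> bool" where
  two: "hexagon H1 \<Longrightarrow> hexagon H2 \<Longrightarrow> gverts H1 \<inter> gverts H2 = {s} \<Longrightarrow>
          spiro_build [] (gunion H1 H2) H2 s"
| attach: "spiro_build ls G H s \<Longrightarrow> i \<in> {1, 2, 3} \<Longrightarrow> w \<in> gverts H \<Longrightarrow> gdist H s w = i \<Longrightarrow>
          hexagon H' \<Longrightarrow> gverts G \<inter> gverts H' = {w} \<Longrightarrow>
          spiro_build (ls @ [i]) (gunion G H') H' w"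

definition spiro_chain :: "nat list \<Rightarrow> 'v graph \<Rightarrow> bool" where
  "spiro_chain ls G \<longleftrightarrow> (\<exists>H s. spiro_build ls G H s)"

text \<open>The value \<open>L n\<close> is the choice made when the \<open>n\<close>-th hexagon is attached, for \<open>n \<ge> 3\<close>. The graph
  \<open>RSC n \<omega>\<close> is only prescribed up to isomorphism, namely as some spiro chain with choices
  \<open>L 3 \<omega>, \<dots>, L n \<omega>\<close>.\<close>

locale random_spiro_chain = prob_space M for M :: "'w measure" +
  fixes p :: "nat \<Rightarrow> real" and L :: "nat \<Rightarrow> 'w \<Rightarrow> nat" and RSC :: "nat \<Rightarrow> 'w \<Rightarrow> 'v graph"
  assumes p_bounds: "\<And>i. i \<in> {1, 2, 3} \<Longrightarrow> 0 < p i \<and> p i < 1"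
    and p_sum: "p 1 + p 2 + p 3 = 1"
    and choices_indep: "indep_vars (\<lambda>_. count_space {1, 2, 3}) L {3..}"
    and choices_prob: "\<And>n i. 3 \<le> n \<Longrightarrow> i \<in> {1, 2, 3} \<Longrightarrow> prob {\<omega> \<in> space M. L n \<omega> = i} = p i"
    and chain_one: "\<And>\<omega>. \<omega> \<in> space M \<Longrightarrow> hexagon (RSC 1 \<omega>)"
    and chain: "\<And>n \<omega>. 2 \<le> n \<Longrightarrow> \<omega> \<in> space M \<Longrightarrow>
                  spiro_chain (map (\<lambda>k. L k \<omega>) [3..<Suc n]) (RSC n \<omega>)"

lemma lessThan_6: "{..<6::nat} = {0,1,2,3,4,5}"
  by auto

lemma hexagon_edges:
  "gedges (cycle_graph [a,b,c,d,e,f]) = {{a,b},{b,c},{c,d},{d,e},{e,f},{f,a}}"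
proof -
  have "gedges (cycle_graph [a,b,c,d,e,f]) =
     (\<lambda>k. {[a,b,c,d,e,f] ! k, [a,b,c,d,e,f] ! (Suc k mod 6)}) ` {..<6}"
    by (auto simp: cycle_graph_def)
  then show ?thesis
    unfolding lessThan_6 by simp
qed

lemma gdist_hexagon:
  assumes "distinct [a,b,c,d,e,f]"
  shows "gdist (cycle_graph [a,b,c,d,e,f]) a b = 1"
    and "gdist (cycle_graph [a,b,c,d,e,f]) a c = 2"
    and "gdist (cycle_graph [a,b,c,d,e,f]) a d = 3"
    and "gdist (cycle_graph [a,b,c,d,e,f]) a e = 2"
    and "gdist (cycle_graph [a,b,c,d,e,f]) a f = 1"
proof -
  define R where "R = {(x, y). {x, y} \<in> gedges (cycle_graph [a,b,c,d,e,f])}"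
  define r :: "'a \<Rightarrow> nat" where
    "r = (\<lambda>x. if x = a then 0 else if x = b \<or> x = f then 1 else if x = c \<or> x = e then 2 else 3)"
  have rv: "r a = 0" "r b = 1" "r f = 1" "r c = 2" "r e = 2" "r d = 3"
    using assms distinct_rev[of "[a,b,c,d,e,f]"] unfolding r_def by simp_all
  have step: "r y \<le> Suc (r x)" if "(x, y) \<in> R" for x y
  proof -
    from that have "{x, y} = {a, b} \<or> {x, y} = {b, c} \<or> {x, y} = {c, d} \<or> {x, y} = {d, e} \<or>
        {x, y} = {e, f} \<or> {x, y} = {f, a}"
      unfolding R_def hexagon_edges by simp
    moreover have "r y \<le> Suc (r x)"
      if "{x, y} = {u, v}" "r u \<le> Suc (r v)" "r v \<le> Suc (r u)" for u v
      using that by (auto simp: doubleton_eq_iff)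
    ultimately show ?thesis
      by (elim disjE) (simp_all add: rv)
  qed
  have low: "r y \<le> k" if "(a, y) \<in> R ^^ k" for k y
    using that
  proof (induction k arbitrary: y)
    case 0
    then show ?case by (simp add: r_def)
  next
    case (Suc k)
    then obtain x where "(a, x) \<in> R ^^ k" "(x, y) \<in> R" by auto
    then show ?case using Suc.IH[of x] step[of x y] by linarith
  qed
  have d: "gdist (cycle_graph [a,b,c,d,e,f]) a y = r y" if "(a, y) \<in> R ^^ r y" for y
    unfolding gdist_def R_def[symmetric] using that low by (intro Least_equality)
  have e: "(a, b) \<in> R" "(a, f) \<in> R" "(b, c) \<in> R" "(f, e) \<in> R" "(c, d) \<in> R"
    unfolding R_def hexagon_edges by (simp_all add: doubleton_eq_iff)
  have w1: "(a, b) \<in> R ^^ 1" "(a, f) \<in> R ^^ 1"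
    using e by simp_all
  have w2: "(a, c) \<in> R ^^ 2" "(a, e) \<in> R ^^ 2"
    using relpow_Suc_I[OF w1(1) e(3)] relpow_Suc_I[OF w1(2) e(4)] by (simp_all only: Suc_1)
  have w3: "(a, d) \<in> R ^^ 3"
    using relpow_Suc_I[OF w2(1) e(5)] by (simp only: eval_nat_numeral)
  show "gdist (cycle_graph [a,b,c,d,e,f]) a b = 1" using d[of b] w1 rv by simp
  show "gdist (cycle_graph [a,b,c,d,e,f]) a c = 2" using d[of c] w2 rv by simp
  show "gdist (cycle_graph [a,b,c,d,e,f]) a d = 3" using d[of d] w3 rv by simp
  show "gdist (cycle_graph [a,b,c,d,e,f]) a e = 2" using d[of e] w2 rv by simp
  show "gdist (cycle_graph [a,b,c,d,e,f]) a f = 1" using d[of f] w1 rv by simp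
qed

lemma fresh_hexagon:
  assumes "infinite (UNIV :: 'v set)" "finite (A :: 'v set)" "w \<in> A"
  obtains b c d e f where "distinct [w,b,c,d,e,f]" "A \<inter> set [w,b,c,d,e,f] = {w}"
proof -
  have "infinite (UNIV - A)" using assms(1,2) by (rule Diff_infinite_finite[rotated])
  then obtain B where B: "B \<subseteq> UNIV - A" "card B = 5" "finite B"
    using infinite_arbitrarily_large by blast
  then obtain bs where bs: "set bs = B" "distinct bs" "length bs = 5"
    using finite_distinct_list distinct_card by metis
  then obtain b c d e f where "bs = [b,c,d,e,f]"
    by (simp add: eval_nat_numeral length_Suc_conv) blast
  with bs B assms(3) show ?thesis by (intro that[of b c d e f]) auto
qed

text \<open>The hypotheses on chains are satisfiable on every infinite vertex type.\<close>

lemma spiro_chain_exists: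
  assumes inf: "infinite (UNIV :: 'v set)" and ls: "set ls \<subseteq> {1, 2, 3}"
  shows "\<exists>G :: 'v graph. spiro_chain ls G"
proof -
  have "\<exists>(G :: 'v graph) H a b c d e f. spiro_build ls G H a \<and> H = cycle_graph [a,b,c,d,e,f] \<and>
          distinct [a,b,c,d,e,f] \<and> finite (gverts G) \<and> gverts H \<subseteq> gverts G"
    using ls
  proof (induction ls rule: rev_induct)
    case Nil
    obtain x :: 'v where True by blast
    obtain b c d e f where 1: "distinct [x,b,c,d,e,f]"
      by (rule fresh_hexagon[OF inf, of "{x}" x]) (simp, simp, blast)
    let ?H1 = "cycle_graph [x,b,c,d,e,f]"
    obtain b' c' d' e' f' where
      2: "distinct [x,b',c',d',e',f']" "set [x,b,c,d,e,f] \<inter> set [x,b',c',d',e',f'] = {x}"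
      by (rule fresh_hexagon[OF inf, of "set [x,b,c,d,e,f]" x]) (simp, simp, blast)
    let ?H2 = "cycle_graph [x,b',c',d',e',f']"
    have "hexagon ?H1" unfolding hexagon_def using 1 by (intro exI[of _ "[x,b,c,d,e,f]"]) simp
    moreover have "hexagon ?H2"
      unfolding hexagon_def using 2 by (intro exI[of _ "[x,b',c',d',e',f']"]) simp
    moreover have "gverts ?H1 \<inter> gverts ?H2 = {x}" using 2 by (simp add: cycle_graph_def)
    ultimately have "spiro_build [] (gunion ?H1 ?H2) ?H2 x" by (rule spiro_build.two)
    moreover have "finite (gverts (gunion ?H1 ?H2))" "gverts ?H2 \<subseteq> gverts (gunion ?H1 ?H2)"
      by (auto simp: gunion_def cycle_graph_def)
    ultimately show ?case using 2(1) by blast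
  next
    case (snoc i ls)
    have "set ls \<subseteq> {1, 2, 3}" using snoc.prems by simp
    with snoc.IH obtain G :: "'v graph" and a b c d e f where
      B: "spiro_build ls G (cycle_graph [a,b,c,d,e,f]) a" "distinct [a,b,c,d,e,f]"
        "finite (gverts G)" "gverts (cycle_graph [a,b,c,d,e,f]) \<subseteq> gverts G"
      by metis
    have i: "i \<in> {1,2,3}" using snoc.prems by simp
    have "{b, c, d} \<subseteq> gverts (cycle_graph [a,b,c,d,e,f])"
      by (simp add: cycle_graph_def)
    with i obtain w where w: "w \<in> gverts (cycle_graph [a,b,c,d,e,f])"
      "gdist (cycle_graph [a,b,c,d,e,f]) a w = i"
      using gdist_hexagon(1-3)[OF B(2)] by blast
    then have "w \<in> gverts G" using B(4) by blast
    then obtain b' c' d' e' f' where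
      2: "distinct [w,b',c',d',e',f']" "gverts G \<inter> set [w,b',c',d',e',f'] = {w}"
      using fresh_hexagon[OF inf B(3)] by blast
    let ?H' = "cycle_graph [w,b',c',d',e',f']"
    have "hexagon ?H'"
      unfolding hexagon_def using 2 by (intro exI[of _ "[w,b',c',d',e',f']"]) simp
    moreover have "gverts G \<inter> gverts ?H' = {w}" using 2 by (simp add: cycle_graph_def)
    ultimately have "spiro_build (ls @ [i]) (gunion G ?H') ?H' w"
      using spiro_build.attach[OF B(1) i w] by blast
    moreover have "finite (gverts (gunion G ?H'))" "gverts ?H' \<subseteq> gverts (gunion G ?H')"
      using B(3) by (auto simp: gunion_def cycle_graph_def)
    ultimately show ?case using 2(1) by blast
  qed
  then show ?thesis unfolding spiro_chain_def by blast
qed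

end

theory Submission
  imports Defs "HOL-Real_Asymp.Real_Asymp"
begin

text \<open>
  Gluing a hexagon to a spiro chain at \<open>w\<close> is a local operation: among the old vertices only \<open>w\<close>
  changes its degree, from 2 to 4, and the other five vertices of the new hexagon have degree 2. A
  vertex index therefore grows by a constant, while an edge index also sees the two neighbours of
  \<open>w\<close> in the last hexagon. Their degrees are 4 and 2 if \<open>w\<close> is adjacent to the vertex shared with
  the previous hexagon, and 2 and 2 otherwise, so they depend only on the distance \<open>i\<close> chosen at
  that step. Hence there are \<open>c\<close> and \<open>\<delta>\<close> such that every spiro chain with choices \<open>ls\<close> has index
  \<open>c + (\<Sum>i\<leftarrow>ls. \<delta> i)\<close> (lemma \<open>topological_index_spiro_chain\<close>). The chains with two and three
  hexagons identify \<open>\<delta> i\<close> as \<open>TI (RSC3 i) - TI RSC2\<close>.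

  Consequently the index of the random chain with \<open>n\<close> hexagons is a constant plus a sum of \<open>n - 2\<close>
  independent identically distributed terms with mean \<open>\<alpha>\<close> and variance \<open>\<beta> - \<alpha>\<^sup>2\<close>, to which the
  central limit theorem applies (lemma \<open>choice_sums_clt\<close>). The additive constant and the
  normalisation by \<open>sqrt n\<close> instead of \<open>sqrt (n - 2)\<close> make no difference in the limit. This is the
  special case of Slutsky's theorem for deterministic affine maps \<open>z \<mapsto> b n + s n * z\<close> with
  convergent coefficients (lemma \<open>weak_conv_m_affine\<close>).
\<close>

section \<open>Gluing simple graphs at a vertex\<close>

definition simple_graph :: "'v graph \<Rightarrow> bool" where
  "simple_graph G \<longleftrightarrow> finite (gverts G) \<and> (\<forall>e\<in>gedges G. e \<subseteq> gverts G \<and> card e = 2)"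

definition incident :: "'v graph \<Rightarrow> 'v \<Rightarrow> 'v set set" where
  "incident G v = {e \<in> gedges G. v \<in> e}"

lemma gdegree_incident: "gdegree G v = card (incident G v)"
  by (simp add: gdegree_def incident_def)

lemma simple_graph_finite_gedges:
  assumes "simple_graph G"
  shows "finite (gedges G)"
proof (rule finite_subset)
  show "gedges G \<subseteq> Pow (gverts G)" "finite (Pow (gverts G))"
    using assms by (auto simp: simple_graph_def)
qed

lemma gverts_gunion [simp]: "gverts (gunion G H) = gverts G \<union> gverts H"
  and gedges_gunion [simp]: "gedges (gunion G H) = gedges G \<union> gedges H"
  by (simp_all add: gunion_def)

lemma simple_graph_gunion:
  "simple_graph G \<Longrightarrow> simple_graph H \<Longrightarrow> simple_graph (gunion G H)"
  by (auto simp: simple_graph_def)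

lemma incident_gunion: "incident (gunion G H) v = incident G v \<union> incident H v"
  by (auto simp: incident_def)

lemma incident_outside: "simple_graph G \<Longrightarrow> v \<notin> gverts G \<Longrightarrow> incident G v = {}"
  by (auto simp: incident_def simple_graph_def)

lemma glued_edges_disjoint:
  assumes "simple_graph G" "simple_graph H" "gverts G \<inter> gverts H = {w}"
  shows "gedges G \<inter> gedges H = {}"
proof (rule ccontr)
  assume "gedges G \<inter> gedges H \<noteq> {}"
  then obtain e where e: "e \<in> gedges G" "e \<in> gedges H" by blast
  then have "e \<subseteq> {w}" "card e = 2"
    using assms unfolding simple_graph_def by blast+
  then show False using card_mono[of "{w}" e] by simp
qed

lemma gdegree_glued:
  assumes "simple_graph G" "simple_graph H" "gverts G \<inter> gverts H = {w}"
  shows "gdegree (gunion G H) v = gdegree G v + gdegree H v"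
  unfolding gdegree_incident incident_gunion
proof (rule card_Un_disjoint)
  show "finite (incident G v)" "finite (incident H v)"
    using assms(1,2)[THEN simple_graph_finite_gedges] by (simp_all add: incident_def)
  show "incident G v \<inter> incident H v = {}"
    using glued_edges_disjoint[OF assms] by (auto simp: incident_def)
qed

lemma gdegree_outside: "simple_graph G \<Longrightarrow> v \<notin> gverts G \<Longrightarrow> gdegree G v = 0"
  by (simp add: gdegree_incident incident_outside)

lemma gdegree_pos:
  assumes "simple_graph G" "e \<in> gedges G" "v \<in> e"
  shows "1 \<le> gdegree G v"
proof -
  have "finite (incident G v)" "e \<in> incident G v"
    using assms simple_graph_finite_gedges[OF assms(1)] by (auto simp: incident_def)
  then have "card (incident G v) \<noteq> 0" by auto
  then show ?thesis by (simp add: gdegree_incident)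
qed

section \<open>Hexagons\<close>

lemma gverts_hexagon: "gverts (cycle_graph [a,b,c,d,e,f]) = {a,b,c,d,e,f}"
  by (simp add: cycle_graph_def)

lemma insert_rotate: "{a, b, c, d, e, f} = {b, c, d, e, f, a}"
  by auto

text \<open>
  Rotation lets any vertex be the first one of the listed cycle, so that local statements about a
  hexagon need only be computed at that vertex.
\<close>

lemma hexagon_rotate: "cycle_graph [a,b,c,d,e,f] = cycle_graph [b,c,d,e,f,a]"
proof (rule prod_eqI)
  show "gverts (cycle_graph [a,b,c,d,e,f]) = gverts (cycle_graph [b,c,d,e,f,a])"
    unfolding gverts_hexagon by (rule insert_rotate)
  show "gedges (cycle_graph [a,b,c,d,e,f]) = gedges (cycle_graph [b,c,d,e,f,a])"
    unfolding hexagon_edges by (rule insert_rotate)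
qed

lemma hexagonE:
  assumes "hexagon H" "s \<in> gverts H"
  obtains b c d e f where "distinct [s,b,c,d,e,f]" "H = cycle_graph [s,b,c,d,e,f]"
proof -
  obtain vs where vs: "length vs = 6" "distinct vs" "H = cycle_graph vs"
    using assms(1) unfolding hexagon_def by blast
  obtain u b c d e f where l: "vs = [u,b,c,d,e,f]"
    using vs(1) by (simp add: eval_nat_numeral length_Suc_conv) blast
  have "s \<in> {u,b,c,d,e,f}" using assms(2) vs(3) l by (simp add: cycle_graph_def)
  then show ?thesis
  proof (elim insertE emptyE)
    assume "s = u" then show ?thesis using vs l that by blast
  next
    assume "s = b"
    then show ?thesis using vs l that[of c d e f u] hexagon_rotate[of u b c d e f] by auto
  next
    assume "s = c"
    then show ?thesis using vs l that[of d e f u b] hexagon_rotate[of u b c d e f]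
      hexagon_rotate[of b c d e f u] by auto
  next
    assume "s = d"
    then show ?thesis using vs l that[of e f u b c] hexagon_rotate[of u b c d e f]
      hexagon_rotate[of b c d e f u] hexagon_rotate[of c d e f u b] by auto
  next
    assume "s = e"
    then show ?thesis using vs l that[of f u b c d] hexagon_rotate[of u b c d e f]
      hexagon_rotate[of b c d e f u] hexagon_rotate[of c d e f u b]
      hexagon_rotate[of d e f u b c] by auto
  next
    assume "s = f"
    then show ?thesis using vs l that[of u b c d e] hexagon_rotate[of f u b c d e] by auto
  qed
qed

lemma card_gverts_hexagon: "hexagon H \<Longrightarrow> card (gverts H) = 6"
  by (auto simp: hexagon_def cycle_graph_def distinct_card)

lemma hexagon_vertexE:
  assumes "hexagon H"
  obtains w where "w \<in> gverts H"
  using card_gverts_hexagon[OF assms] by (metis all_not_in_conv card.empty zero_neq_numeral)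

lemma hexagon_simple_graph:
  assumes "hexagon H" shows "simple_graph H"
proof -
  obtain s where "s \<in> gverts H" using hexagon_vertexE[OF assms] .
  then obtain b c d e f where "distinct [s,b,c,d,e,f]" "H = cycle_graph [s,b,c,d,e,f]"
    using hexagonE[OF assms] by blast
  then show ?thesis
    using gverts_hexagon[of s b c d e f] unfolding simple_graph_def by (auto simp: hexagon_edges)
qed

lemma incident_hexagon:
  assumes "distinct [w,b,c,d,e,f]"
  shows "incident (cycle_graph [w,b,c,d,e,f]) w = {{w,b},{w,f}}"
  unfolding incident_def hexagon_edges using assms by auto

lemma gdegree_hexagon:
  assumes "hexagon H" "v \<in> gverts H"
  shows "gdegree H v = 2"
proof -
  obtain b c d e f where 1: "distinct [v,b,c,d,e,f]" "H = cycle_graph [v,b,c,d,e,f]"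
    using hexagonE[OF assms] .
  have "{v, b} \<noteq> {v, f}" using 1(1) by (auto simp: doubleton_eq_iff)
  then show ?thesis
    unfolding gdegree_incident 1(2) incident_hexagon[OF 1(1)] by simp
qed

text \<open>
  This is how the distance \<open>i\<close> enters the increment of an index: for \<open>i = 1\<close>, exactly one neighbour
  of \<open>w\<close> is the vertex \<open>s\<close> shared with the previous hexagon; for \<open>i = 2\<close> and \<open>i = 3\<close>, none is. The
  neighbour that may be \<open>s\<close> is called \<open>x\<close>.
\<close>

lemma hexagon_neighbours_at_distance:
  assumes "hexagon H" "s \<in> gverts H" "w \<in> gverts H" "gdist H s w = i" "i \<noteq> 0"
  obtains x y where "x \<noteq> y" "incident H w = {{w, x}, {w, y}}" "x \<in> gverts H" "y \<in> gverts H"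
    "y \<noteq> s" "x = s \<longleftrightarrow> i = 1" "w \<noteq> s"
proof -
  obtain b c d e f where 1: "distinct [s,b,c,d,e,f]" and H: "H = cycle_graph [s,b,c,d,e,f]"
    using hexagonE[OF assms(1,2)] .
  note dist = gdist_hexagon[OF 1, folded H]
  note rot = hexagon_rotate[of s b c d e f] hexagon_rotate[of b c d e f s]
    hexagon_rotate[of c d e f s b] hexagon_rotate[of d e f s b c] hexagon_rotate[of e f s b c d]
  have V: "gverts H = {s,b,c,d,e,f}" unfolding H by (simp add: cycle_graph_def)
  have "gdist H s s = 0" unfolding gdist_def by (rule Least_eq_0) simp
  then have "w \<noteq> s" using assms(4,5) by metis
  then have "w \<in> {b,c,d,e,f}" using assms(3) V by blast
  then show ?thesis
  proof (elim insertE emptyE)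
    assume w: "w = b"
    have "incident H w = {{w, c}, {w, s}}"
      unfolding H w rot(1) by (rule incident_hexagon) (use 1 in auto)
    then have "incident H w = {{w, s}, {w, c}}" by (simp only: insert_commute)
    moreover have "i = 1" using dist assms(4) w by simp
    ultimately show ?thesis using 1 V w that[of s c] by auto
  next
    assume w: "w = c"
    have "incident H w = {{w, d}, {w, b}}"
      unfolding H w rot(1,2) by (rule incident_hexagon) (use 1 in auto)
    moreover have "i = 2" using dist assms(4) w by simp
    ultimately show ?thesis using 1 V w that[of d b] by auto
  next
    assume w: "w = d"
    have "incident H w = {{w, e}, {w, c}}"
      unfolding H w rot(1-3) by (rule incident_hexagon) (use 1 in auto)
    moreover have "i = 3" using dist assms(4) w by simp
    ultimately show ?thesis using 1 V w that[of e c] by auto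
  next
    assume w: "w = e"
    have "incident H w = {{w, f}, {w, d}}"
      unfolding H w rot(1-4) by (rule incident_hexagon) (use 1 in auto)
    moreover have "i = 2" using dist assms(4) w by simp
    ultimately show ?thesis using 1 V w that[of f d] by auto
  next
    assume w: "w = f"
    have "incident H w = {{w, s}, {w, e}}"
      unfolding H w rot(1-5) by (rule incident_hexagon) (use 1 in auto)
    moreover have "i = 1" using dist assms(4) w by simp
    ultimately show ?thesis using 1 V w that[of s e] by auto
  qed
qed

section \<open>The effect of gluing on a topological index\<close>

text \<open>
  The vertex \<open>w\<close> trades its contribution of degree 2 for one of degree 4, and five vertices of
  degree 2 are added; this is a net gain of four vertices of degree 2 and one of degree 4.
\<close>

lemma vertex_index_attach:
  assumes G: "simple_graph G" "gdegree G w = 2"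
    and H: "hexagon H" and glue: "gverts G \<inter> gverts H = {w}"
  shows "vertex_index h a (gunion G H) = vertex_index h a G + (4 * h 2 powr a + h 4 powr a)"
proof -
  note sH = hexagon_simple_graph[OF H]
  let ?d = "gdegree (gunion G H)" and ?t = "\<lambda>k. h k powr a"
  note deg = gdegree_glued[OF G(1) sH glue]
  have w: "w \<in> gverts G" "w \<in> gverts H" using glue by auto
  have fin: "finite (gverts G)" "finite (gverts H)"
    using G sH by (auto simp: simple_graph_def)
  have outside: "v \<notin> gverts H" if "v \<in> gverts G - {w}" for v
    using that glue by blast
  have new: "?d v = 2" if "v \<in> gverts H - {w}" for v
  proof -
    have "v \<notin> gverts G" using that glue by blast
    then show ?thesis
      using that by (simp add: deg gdegree_outside[OF G(1)] gdegree_hexagon[OF H])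
  qed
  have V: "gverts (gunion G H) = insert w ((gverts G - {w}) \<union> (gverts H - {w}))"
    unfolding gverts_gunion using w by blast
  have "vertex_index h a (gunion G H)
      = ?t (?d w) + (\<Sum>v\<in>(gverts G - {w}) \<union> (gverts H - {w}). ?t (?d v))"
    unfolding vertex_index_def V by (rule sum.insert) (use fin in simp_all)
  also have "(\<Sum>v\<in>(gverts G - {w}) \<union> (gverts H - {w}). ?t (?d v))
      = (\<Sum>v\<in>gverts G - {w}. ?t (?d v)) + (\<Sum>v\<in>gverts H - {w}. ?t (?d v))"
  proof (rule sum.union_disjoint)
    show "(gverts G - {w}) \<inter> (gverts H - {w}) = {}" using glue by blast
  qed (use fin in simp_all)
  also have "(\<Sum>v\<in>gverts G - {w}. ?t (?d v)) = (\<Sum>v\<in>gverts G - {w}. ?t (gdegree G v))"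
    by (intro sum.cong refl) (simp add: deg gdegree_outside[OF sH] outside)
  also have "\<dots> = vertex_index h a G - ?t 2"
    unfolding vertex_index_def using fin w G(2) by (simp add: sum_diff1)
  also have "(\<Sum>v\<in>gverts H - {w}. ?t (?d v)) = (\<Sum>v\<in>gverts H - {w}. ?t 2)"
    by (intro sum.cong refl) (simp only: new)
  also have "\<dots> = 5 * ?t 2"
    using card_gverts_hexagon[OF H] fin w by simp
  also have "?d w = 4"
    using G(2) gdegree_hexagon[OF H w(2)] by (simp add: deg)
  finally show ?thesis by simp
qed

text \<open>
  The degree function is a separate argument, so that the same edge can be weighed before and after
  gluing.
\<close>

definition edge_weight :: "(nat \<Rightarrow> nat \<Rightarrow> real) \<Rightarrow> real \<Rightarrow> ('v \<Rightarrow> nat) \<Rightarrow> 'v set \<Rightarrow> real" where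
  "edge_weight f a d e = (THE c. \<exists>u v. e = {u, v} \<and> c = f (d u) (d v) powr a)"

lemma edge_index_eq_sum_weight:
  "edge_index f a G = (\<Sum>e\<in>gedges G. edge_weight f a (gdegree G) e)"
  by (simp add: edge_index_def edge_weight_def)

lemma edge_weight_doubleton:
  assumes "f (d x) (d y) = f (d y) (d x)"
  shows "edge_weight f a d {x, y} = f (d x) (d y) powr a"
  unfolding edge_weight_def
  by (rule the_equality) (use assms in \<open>auto simp: doubleton_eq_iff\<close>)

lemma edge_weight_cong:
  assumes "\<And>v. v \<in> e \<Longrightarrow> d v = d' v"
  shows "edge_weight f a d e = edge_weight f a d' e"
proof -
  have "e = {u, v} \<and> c = f (d u) (d v) powr a \<longleftrightarrow> e = {u, v} \<and> c = f (d' u) (d' v) powr a"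
    for u v c
    using assms[of u] assms[of v] by auto
  then show ?thesis by (simp add: edge_weight_def)
qed

text \<open>
  The parameter \<open>k\<close> is 4 for a hexagon that has been glued at \<open>w\<close>, and 2 for an isolated hexagon.
\<close>

lemma hexagon_weight_sum:
  assumes "hexagon H" "w \<in> gverts H" "d w = k" "\<And>v. v \<in> gverts H - {w} \<Longrightarrow> d v = 2"
    and sym: "f k 2 = f 2 k"
  shows "(\<Sum>e\<in>gedges H. edge_weight f a d e) = 2 * f k 2 powr a + 4 * f 2 2 powr a"
proof -
  obtain b c u e t where 1: "distinct [w,b,c,u,e,t]" and H: "H = cycle_graph [w,b,c,u,e,t]"
    using hexagonE[OF assms(1,2)] .
  have "gverts H = {w,b,c,u,e,t}" unfolding H by (simp add: cycle_graph_def)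
  then have d: "d w = k" "d b = 2" "d c = 2" "d u = 2" "d e = 2" "d t = 2"
    using assms(3,4) 1 by auto
  have "edge_weight f a d {w,b} = f k 2 powr a" "edge_weight f a d {t,w} = f k 2 powr a"
    "edge_weight f a d {b,c} = f 2 2 powr a" "edge_weight f a d {c,u} = f 2 2 powr a"
    "edge_weight f a d {u,e} = f 2 2 powr a" "edge_weight f a d {e,t} = f 2 2 powr a"
    by (subst edge_weight_doubleton; simp add: d sym)+
  moreover have "distinct [t,e,u,c,b,w]" using 1 by auto
  ultimately show ?thesis
    unfolding H hexagon_edges using 1 by (simp add: doubleton_eq_iff)
qed

text \<open>
  Among the old edges, only the two at \<open>w\<close> have an endpoint whose degree changes; \<open>g\<close> is the
  resulting change of weight of such an edge as a function of the degree of its other endpoint. The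
  remaining summands are the weights of the six new edges.
\<close>

lemma edge_index_attach:
  fixes f :: "nat \<Rightarrow> nat \<Rightarrow> real" and a :: real
  assumes G: "simple_graph G" "incident G w = {{w, x}, {w, y}}" "x \<noteq> y"
    and H: "hexagon H" and glue: "gverts G \<inter> gverts H = {w}"
    and sym: "\<And>k l. 1 \<le> k \<Longrightarrow> 1 \<le> l \<Longrightarrow> f k l = f l k"
  defines "g \<equiv> \<lambda>k. f 4 k powr a - f 2 k powr a"
  shows "edge_index f a (gunion G H) = edge_index f a G +
    (g (gdegree G x) + g (gdegree G y) + 2 * f 4 2 powr a + 4 * f 2 2 powr a)"
proof -
  note sH = hexagon_simple_graph[OF H]
  let ?d = "gdegree (gunion G H)" and ?W = "edge_weight f a"
  note deg = gdegree_glued[OF G(1) sH glue]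
  have w: "w \<in> gverts G" "w \<in> gverts H" using glue by auto
  have fin: "finite (gedges G)" "finite (gedges H)"
    using G(1) sH by (auto simp: simple_graph_finite_gedges)
  have inc: "{w, x} \<in> gedges G" "{w, y} \<in> gedges G"
    using G(2) unfolding incident_def by blast+
  have x: "x \<in> gverts G" "x \<noteq> w" and y: "y \<in> gverts G" "y \<noteq> w"
    using inc G(1) by (auto simp: simple_graph_def)
  have ne: "{w, x} \<noteq> {w, y}" using G(3) by (auto simp: doubleton_eq_iff)
  have dw: "gdegree G w = 2" unfolding gdegree_incident G(2) using ne by simp
  have pos: "1 \<le> gdegree G x" "1 \<le> gdegree G y"
    using gdegree_pos[OF G(1) inc(1), of x] gdegree_pos[OF G(1) inc(2), of y] by auto
  have dG: "?d v = gdegree G v" if "v \<in> gverts G" "v \<noteq> w" for v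
  proof -
    have "v \<notin> gverts H" using that glue by blast
    then show ?thesis by (simp add: deg gdegree_outside[OF sH])
  qed
  have d: "?d w = 4" "?d x = gdegree G x" "?d y = gdegree G y"
    using dw gdegree_hexagon[OF H w(2)] dG x y by (simp_all add: deg)
  have split: "(\<Sum>e\<in>gedges G. F e) = F {w, x} + F {w, y} + (\<Sum>e\<in>gedges G - incident G w. F e)"
    for F :: "'a set \<Rightarrow> real"
    using sum.subset_diff[of "incident G w" "gedges G" F] fin(1) ne
    by (simp add: G(2) inc)
  have rest: "(\<Sum>e\<in>gedges G - incident G w. ?W ?d e)
      = (\<Sum>e\<in>gedges G - incident G w. ?W (gdegree G) e)"
  proof (intro sum.cong refl edge_weight_cong)
    fix e v assume "e \<in> gedges G - incident G w" "v \<in> e"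
    then have "v \<in> gverts G" "v \<noteq> w" using G(1) by (auto simp: incident_def simple_graph_def)
    then show "?d v = gdegree G v" by (rule dG)
  qed
  have weight: "?W d {u, v} = f (d u) (d v) powr a" if "1 \<le> d u" "1 \<le> d v" for d u v
    using sym[OF that] by (rule edge_weight_doubleton)
  have new: "?W ?d {w, x} = f 4 (gdegree G x) powr a" "?W ?d {w, y} = f 4 (gdegree G y) powr a"
    using weight[of ?d w x] weight[of ?d w y] pos by (simp_all add: d)
  have old: "?W (gdegree G) {w, x} = f 2 (gdegree G x) powr a"
    "?W (gdegree G) {w, y} = f 2 (gdegree G y) powr a"
    using weight[of "gdegree G" w x] weight[of "gdegree G" w y] pos by (simp_all add: dw)
  have hex: "(\<Sum>e\<in>gedges H. ?W ?d e) = 2 * f 4 2 powr a + 4 * f 2 2 powr a"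
  proof (rule hexagon_weight_sum[where w = w and d = ?d, OF H w(2) d(1)])
    fix v assume v: "v \<in> gverts H - {w}"
    then have "v \<notin> gverts G" using glue by blast
    then show "?d v = 2"
      using v by (simp add: deg gdegree_outside[OF G(1)] gdegree_hexagon[OF H])
  qed (simp add: sym)
  have "edge_index f a (gunion G H) = (\<Sum>e\<in>gedges G. ?W ?d e) + (\<Sum>e\<in>gedges H. ?W ?d e)"
    unfolding edge_index_eq_sum_weight gedges_gunion
    using fin glued_edges_disjoint[OF G(1) sH glue] by (rule sum.union_disjoint)
  then show ?thesis
    unfolding edge_index_eq_sum_weight[of f a G] split[of "?W ?d"] split[of "?W (gdegree G)"]
      rest new old hex g_def by simp
qed

text \<open>
  Both kinds of index share one locality property, and the analysis of chains uses only this.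
\<close>

lemma topological_index_attach:
  fixes TI :: "'v graph \<Rightarrow> real"
  assumes "topological_index a TI"
  obtains c0 :: real and \<delta> :: "nat \<Rightarrow> nat \<Rightarrow> real"
  where "\<And>H. hexagon H \<Longrightarrow> TI H = c0"
    and "\<And>G H w x y. simple_graph G \<Longrightarrow> incident G w = {{w, x}, {w, y}} \<Longrightarrow> x \<noteq> y \<Longrightarrow>
        hexagon H \<Longrightarrow> gverts G \<inter> gverts H = {w} \<Longrightarrow>
        TI (gunion G H) = TI G + \<delta> (gdegree G x) (gdegree G y)"
  using assms unfolding topological_index_def
proof (elim disjE exE conjE)
  fix h :: "nat \<Rightarrow> real"
  assume TI: "TI = vertex_index h a"
  show ?thesis
  proof (rule that[of "6 * h 2 powr a" "\<lambda>_ _. 4 * h 2 powr a + h 4 powr a"])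
    fix H :: "'v graph" assume "hexagon H"
    then show "TI H = 6 * h 2 powr a"
      by (simp add: TI vertex_index_def gdegree_hexagon card_gverts_hexagon)
  next
    fix G H :: "'v graph" and w x y
    assume A: "simple_graph G" "incident G w = {{w, x}, {w, y}}" "x \<noteq> y"
      "hexagon H" "gverts G \<inter> gverts H = {w}"
    have "{w, x} \<noteq> {w, y}" using A(3) by (auto simp: doubleton_eq_iff)
    then have "gdegree G w = 2" unfolding gdegree_incident A(2) by simp
    then show "TI (gunion G H) = TI G + (4 * h 2 powr a + h 4 powr a)"
      unfolding TI using A(1,4,5) by (intro vertex_index_attach)
  qed
next
  fix f :: "nat \<Rightarrow> nat \<Rightarrow> real"
  assume f: "\<forall>k\<ge>1. \<forall>l\<ge>1. 0 < f k l \<and> f k l = f l k" and TI: "TI = edge_index f a"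
  define g where "g k = f 4 k powr a - f 2 k powr a" for k
  show ?thesis
  proof (rule that[of "6 * f 2 2 powr a"
        "\<lambda>j k. g j + g k + 2 * f 4 2 powr a + 4 * f 2 2 powr a"])
    fix H :: "'v graph" assume H: "hexagon H"
    obtain w where w: "w \<in> gverts H" using hexagon_vertexE[OF H] .
    show "TI H = 6 * f 2 2 powr a"
      unfolding TI edge_index_eq_sum_weight
      by (subst hexagon_weight_sum[OF H w, where k = 2]) (auto simp: gdegree_hexagon[OF H] w)
  next
    fix G H :: "'v graph" and w x y
    assume A: "simple_graph G" "incident G w = {{w, x}, {w, y}}" "x \<noteq> y"
      "hexagon H" "gverts G \<inter> gverts H = {w}"
    show "TI (gunion G H) = TI G + (g (gdegree G x) + g (gdegree G y)
        + 2 * f 4 2 powr a + 4 * f 2 2 powr a)"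
      unfolding TI g_def by (rule edge_index_attach[OF A]) (use f in blast)
  qed
qed

section \<open>The index of a spiro chain is a sum over the choices\<close>

text \<open>
  The invariant of the construction: \<open>s\<close> is the only vertex of the last hexagon \<open>H\<close> that also
  belongs to another hexagon. Around every other vertex of \<open>H\<close>, the chain \<open>G\<close> looks like \<open>H\<close> alone.
\<close>

definition end_hexagon :: "'v graph \<Rightarrow> 'v graph \<Rightarrow> 'v \<Rightarrow> bool" where
  "end_hexagon G H s \<longleftrightarrow> simple_graph G \<and> hexagon H \<and> s \<in> gverts H \<and> gdegree G s = 4 \<and>
     (\<forall>v\<in>gverts H - {s}. incident G v = incident H v)"

lemma end_hexagon_attach:
  assumes G: "simple_graph G" "gdegree G w = 2"
    and H: "hexagon H" and glue: "gverts G \<inter> gverts H = {w}"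
  shows "end_hexagon (gunion G H) H w"
proof -
  note sH = hexagon_simple_graph[OF H]
  have w: "w \<in> gverts H" using glue by auto
  have "gdegree (gunion G H) w = 4"
    using G(2) gdegree_hexagon[OF H w] by (simp add: gdegree_glued[OF G(1) sH glue])
  moreover have "incident (gunion G H) v = incident H v" if "v \<in> gverts H - {w}" for v
  proof -
    have "v \<notin> gverts G" using that glue by blast
    then show ?thesis by (simp add: incident_gunion incident_outside[OF G(1)])
  qed
  ultimately show ?thesis
    using H w simple_graph_gunion[OF G(1) sH] by (simp add: end_hexagon_def)
qed

lemma end_hexagon_attachment_vertex:
  assumes "end_hexagon G H s" "w \<in> gverts H" "gdist H s w = i" "i \<noteq> 0"
  obtains x y where "x \<noteq> y" "incident G w = {{w, x}, {w, y}}"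
    "gdegree G x = (if i = 1 then 4 else 2)" "gdegree G y = 2" "gdegree G w = 2"
proof -
  have H: "hexagon H" "s \<in> gverts H" "gdegree G s = 4"
    using assms(1) by (simp_all add: end_hexagon_def)
  have inc: "incident G v = incident H v" if "v \<in> gverts H" "v \<noteq> s" for v
    using assms(1) that by (simp add: end_hexagon_def)
  have two: "gdegree G v = 2" if "v \<in> gverts H" "v \<noteq> s" for v
    using gdegree_hexagon[OF H(1) that(1)] by (simp add: gdegree_incident inc[OF that])
  obtain x y where "x \<noteq> y" "incident H w = {{w, x}, {w, y}}" "x \<in> gverts H" "y \<in> gverts H"
    "y \<noteq> s" "x = s \<longleftrightarrow> i = 1" "w \<noteq> s"
    using hexagon_neighbours_at_distance[OF H(1,2) assms(2,3,4)] .
  then show ?thesis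
    using that[of x y] inc[of w] two H(3) assms(2) by auto
qed

text \<open>
  Induction over the construction, where the base case is itself a gluing step at a vertex of an
  isolated hexagon, both of whose neighbours have degree 2.
\<close>

lemma topological_index_spiro_chain:
  fixes TI :: "'v graph \<Rightarrow> real"
  assumes "topological_index a TI"
  obtains c :: real and \<delta> :: "nat \<Rightarrow> real"
  where "\<And>ls G. spiro_chain ls G \<Longrightarrow> TI G = c + sum_list (map \<delta> ls)"
proof -
  obtain c0 :: real and \<delta> where hex: "\<And>H. hexagon H \<Longrightarrow> TI H = c0"
    and att: "\<And>G H w x y. simple_graph G \<Longrightarrow> incident G w = {{w, x}, {w, y}} \<Longrightarrow> x \<noteq> y \<Longrightarrow>
        hexagon H \<Longrightarrow> gverts G \<inter> gverts H = {w} \<Longrightarrow>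
        TI (gunion G H) = TI G + \<delta> (gdegree G x) (gdegree G y)"
    using topological_index_attach[OF assms] by blast
  define \<delta>' where "\<delta>' i = (if i = 1 then \<delta> 4 2 else \<delta> 2 2)" for i :: nat
  have "end_hexagon G H s \<and> TI G = (c0 + \<delta> 2 2) + sum_list (map \<delta>' ls)"
    if "spiro_build ls G H s" for ls and G H :: "'v graph" and s
    using that
  proof (induction rule: spiro_build.induct)
    case (two H1 H2 s)
    have s: "s \<in> gverts H1" using two.hyps(3) by blast
    note H1 = hexagon_simple_graph[OF two.hyps(1)] gdegree_hexagon[OF two.hyps(1)]
    obtain b c d e f where 1: "distinct [s,b,c,d,e,f]" and H: "H1 = cycle_graph [s,b,c,d,e,f]"
      using hexagonE[OF two.hyps(1) s] .
    have "gdegree H1 b = 2" "gdegree H1 f = 2"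
      by (rule H1(2), simp add: H cycle_graph_def)+
    moreover have "TI (gunion H1 H2) = TI H1 + \<delta> (gdegree H1 b) (gdegree H1 f)"
      using 1 incident_hexagon[OF 1, folded H] two.hyps by (intro att[where w = s] H1) auto
    ultimately have "TI (gunion H1 H2) = c0 + \<delta> 2 2"
      using hex[OF two.hyps(1)] by simp
    then show ?case
      using end_hexagon_attach[OF H1(1) H1(2)[OF s] two.hyps(2,3)] by simp
  next
    case (attach ls G H s i w H')
    then have E: "end_hexagon G H s" and "i \<noteq> 0" by auto
    then obtain x y where xy: "x \<noteq> y" "incident G w = {{w, x}, {w, y}}"
      "gdegree G x = (if i = 1 then 4 else 2)" "gdegree G y = 2" "gdegree G w = 2"
      using end_hexagon_attachment_vertex attach.hyps by metis
    have G: "simple_graph G" using E by (simp add: end_hexagon_def)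
    have "TI (gunion G H') = TI G + \<delta>' i"
      using att[OF G xy(2,1) attach.hyps(5,6)] xy(3,4) by (simp add: \<delta>'_def)
    then show ?case
      using attach.IH end_hexagon_attach[OF G xy(5) attach.hyps(5,6)] by simp
  qed
  then have "TI G = (c0 + \<delta> 2 2) + sum_list (map \<delta>' ls)" if "spiro_chain ls G" for ls G
    using that unfolding spiro_chain_def by blast
  then show ?thesis by (rule that)
qed

section \<open>Weak convergence under affine maps with convergent coefficients\<close>

text \<open>
  Monotonicity replaces uniform convergence: \<open>u n\<close> is eventually bounded on either side by a fixed
  point near \<open>x\<close>, where pointwise convergence can be used.
\<close>

lemma mono_functions_tendsto_at_moving_point:
  fixes F :: "nat \<Rightarrow> real \<Rightarrow> real"
  assumes mono: "\<And>n. mono (F n)" and lim: "\<And>x. (\<lambda>n. F n x) \<longlonglongrightarrow> G x"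
    and cont: "isCont G x" and x: "u \<longlonglongrightarrow> x"
  shows "(\<lambda>n. F n (u n)) \<longlonglongrightarrow> G x"
proof (rule order_tendstoI)
  fix c assume "c < G x"
  then have "eventually (\<lambda>y. c < G y) (at_left x)"
    using order_tendstoD(1)[of G "G x" "at_left x" c] cont
    by (simp add: isCont_def filterlim_at_split)
  then have "eventually (\<lambda>y. c < G y \<and> y < x) (at_left x)"
    by (intro eventually_conj) (auto simp: eventually_at_filter)
  then obtain y where y: "c < G y" "y < x"
    using eventually_happens'[OF trivial_limit_at_left_real] by blast
  have "eventually (\<lambda>n. c < F n y) sequentially" "eventually (\<lambda>n. y < u n) sequentially"
    using order_tendstoD(1)[OF lim y(1)] order_tendstoD(1)[OF x y(2)] .
  then show "eventually (\<lambda>n. c < F n (u n)) sequentially"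
    by eventually_elim (use mono in \<open>meson less_le_trans less_imp_le monoD\<close>)
next
  fix c assume "G x < c"
  then have "eventually (\<lambda>y. G y < c) (at_right x)"
    using order_tendstoD(2)[of G "G x" "at_right x" c] cont
    by (simp add: isCont_def filterlim_at_split)
  then have "eventually (\<lambda>y. G y < c \<and> x < y) (at_right x)"
    by (intro eventually_conj) (auto simp: eventually_at_filter)
  then obtain y where y: "G y < c" "x < y"
    using eventually_happens'[OF trivial_limit_at_right_real] by blast
  have "eventually (\<lambda>n. F n y < c) sequentially" "eventually (\<lambda>n. u n < y) sequentially"
    using order_tendstoD(2)[OF lim y(1)] order_tendstoD(2)[OF x y(2)] .
  then show "eventually (\<lambda>n. F n (u n) < c) sequentially"
    by eventually_elim (use mono in \<open>meson le_less_trans less_imp_le monoD\<close>)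
qed

lemma cdf_distr_affine:
  fixes X :: "'a \<Rightarrow> real"
  assumes [measurable]: "X \<in> borel_measurable M" and s: "0 < s"
  shows "cdf (distr M borel (\<lambda>\<omega>. b + s * X \<omega>)) x = cdf (distr M borel X) ((x - b) / s)"
proof -
  have "(\<lambda>\<omega>. b + s * X \<omega>) -` {..x} \<inter> space M = X -` {..(x - b) / s} \<inter> space M"
    using s by (auto simp: field_simps)
  then show ?thesis by (simp add: cdf_def measure_distr)
qed

text \<open>
  The affine map is absorbed into the argument: the distribution function of \<open>b n + s n * Z n\<close> at
  \<open>x\<close> is that of \<open>Z n\<close> at the point \<open>(x - b n) / s n\<close>, which moves to \<open>(x - \<mu>) / \<sigma>\<close>. As \<open>N\<close> has no
  atoms, its distribution function is continuous there.
\<close>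

lemma (in prob_space) weak_conv_m_affine:
  fixes Z :: "nat \<Rightarrow> 'a \<Rightarrow> real"
  assumes Z [measurable]: "\<And>n. random_variable borel (Z n)"
    and N: "real_distribution N" "\<And>x. measure N {x} = 0"
    and conv: "weak_conv_m (\<lambda>n. distr M borel (Z n)) N"
    and s: "s \<longlonglongrightarrow> \<sigma>" "0 < \<sigma>" and b: "b \<longlonglongrightarrow> \<mu>"
  shows "weak_conv_m (\<lambda>n. distr M borel (\<lambda>\<omega>. b n + s n * Z n \<omega>)) (distr N borel (\<lambda>x. \<mu> + \<sigma> * x))"
  unfolding weak_conv_m_def weak_conv_def
proof (intro allI impI)
  fix x
  interpret N: real_distribution N by fact
  have cont: "isCont (cdf N) y" for y using N(2) by (simp add: N.isCont_cdf)
  have "distr N borel (\<lambda>x. x) = N" by (rule distr_id2) simp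
  then have lim: "cdf (distr N borel (\<lambda>x. \<mu> + \<sigma> * x)) x = cdf N ((x - \<mu>) / \<sigma>)"
    using cdf_distr_affine[of "\<lambda>x. x" N \<sigma> \<mu> x] s(2) by simp
  have pos: "eventually (\<lambda>n. 0 < s n) sequentially" using order_tendstoD(1)[OF s] .
  have "(\<lambda>n. cdf (distr M borel (Z n)) ((x - b n) / s n)) \<longlonglongrightarrow> cdf N ((x - \<mu>) / \<sigma>)"
  proof (rule mono_functions_tendsto_at_moving_point[where x = "(x - \<mu>) / \<sigma>"
        and F = "\<lambda>n. cdf (distr M borel (Z n))" and G = "cdf N"])
    show "mono (cdf (distr M borel (Z n)))" for n
    proof -
      interpret Z: real_distribution "distr M borel (Z n)"
        by (rule real_distribution_distr) (rule Z)
      show ?thesis by (simp add: mono_def Z.cdf_nondecreasing)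
    qed
    show "(\<lambda>n. cdf (distr M borel (Z n)) y) \<longlonglongrightarrow> cdf N y" for y
      using conv cont by (simp add: weak_conv_m_def weak_conv_def)
    show "isCont (cdf N) ((x - \<mu>) / \<sigma>)" by (rule cont)
    show "(\<lambda>n. (x - b n) / s n) \<longlonglongrightarrow> (x - \<mu>) / \<sigma>"
      using s b by (intro tendsto_intros) auto
  qed
  moreover have "eventually (\<lambda>n. cdf (distr M borel (Z n)) ((x - b n) / s n)
      = cdf (distr M borel (\<lambda>\<omega>. b n + s n * Z n \<omega>)) x) sequentially"
    using pos by eventually_elim (simp add: cdf_distr_affine)
  ultimately show "(\<lambda>n. cdf (distr M borel (\<lambda>\<omega>. b n + s n * Z n \<omega>)) x)
      \<longlonglongrightarrow> cdf (distr N borel (\<lambda>x. \<mu> + \<sigma> * x)) x"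
    unfolding lim by (rule Lim_transform_eventually)
qed

lemma distr_std_normal_affine:
  assumes "0 < \<sigma>"
  shows "distr std_normal_distribution borel (\<lambda>x. \<mu> + \<sigma> * x)
       = density lborel (normal_density \<mu> \<sigma>)"
proof -
  interpret N: prob_space std_normal_distribution by (rule prob_space_normal_density) simp
  have "distr std_normal_distribution lborel (\<lambda>x. x) = std_normal_distribution"
    by (rule distr_id2) simp
  then have "distributed std_normal_distribution lborel (\<lambda>x. x) (normal_density 0 1)"
    by (simp add: distributed_def)
  from N.normal_density_affine[OF this, of \<sigma> \<mu>] assms
  have "distr std_normal_distribution lborel (\<lambda>x. \<mu> + \<sigma> * x)
      = density lborel (normal_density \<mu> \<sigma>)"
    by (simp add: distributed_def)
  then show ?thesis by (simp cong: distr_cong)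
qed

lemma measure_std_normal_singleton: "measure std_normal_distribution {x} = 0"
proof -
  have "AE y in lborel. y \<in> {x} \<longrightarrow> ennreal (std_normal_density y) = 0"
    using AE_lborel_singleton[of x] by eventually_elim simp
  then have "{x} \<in> null_sets std_normal_distribution"
    by (subst null_sets_density_iff) simp_all
  then have "emeasure std_normal_distribution {x} = 0" by auto
  then show ?thesis by (simp add: measure_def)
qed

section \<open>Sums over the random choices\<close>

lemma (in prob_space) indep_vars_reindex:
  assumes "indep_vars M' X (f ` J)" "inj_on f J"
  shows "indep_vars (\<lambda>j. M' (f j)) (\<lambda>j. X (f j)) J"
  unfolding indep_vars_def2
proof (intro conjI ballI)
  show "random_variable (M' (f j)) (X (f j))" if "j \<in> J" for j
    using assms(1) that by (auto simp: indep_vars_def2)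
  let ?F = "\<lambda>i. {X i -` A \<inter> space M |A. A \<in> sets (M' i)}"
  have F: "indep_sets ?F (f ` J)" using assms(1) by (simp add: indep_vars_def2)
  show "indep_sets (\<lambda>j. ?F (f j)) J"
  proof (rule indep_setsI)
    show "?F (f j) \<subseteq> events" if "j \<in> J" for j
      using F that by (auto simp: indep_sets_def)
  next
    fix A K assume K: "K \<noteq> {}" "K \<subseteq> J" "finite K" and A: "\<forall>j\<in>K. A j \<in> ?F (f j)"
    define g where "g = the_inv_into J f"
    have g: "g (f j) = j" if "j \<in> K" for j
      using that K(2) assms(2) by (auto simp: g_def the_inv_into_f_f)
    have inj: "inj_on f K" using assms(2) K(2) by (rule inj_on_subset)
    have "prob (\<Inter>i\<in>f ` K. A (g i)) = (\<Prod>i\<in>f ` K. prob (A (g i)))"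
      using F K A g by (intro indep_setsD[OF F]) auto
    also have "\<dots> = (\<Prod>j\<in>K. prob (A j))"
      using g by (simp add: prod.reindex[OF inj])
    also have "(\<Inter>i\<in>f ` K. A (g i)) = (\<Inter>j\<in>K. A j)" using g by auto
    finally show "prob (\<Inter>j\<in>K. A j) = (\<Prod>j\<in>K. prob (A j))" .
  qed
qed

context random_spiro_chain begin

lemma choice_measurable: "3 \<le> n \<Longrightarrow> L n \<in> measurable M (count_space {1, 2, 3})"
  using choices_indep by (auto simp: indep_vars_def2)

lemma choice_distr:
  assumes "3 \<le> n"
  shows "distr M (count_space {1, 2, 3}) (L n) = distr M (count_space {1, 2, 3}) (L 3)"
proof (rule measure_eqI_finite)
  fix i :: nat assume i: "i \<in> {1, 2, 3}"
  have "emeasure (distr M (count_space {1, 2, 3}) (L k)) {i} = ennreal (p i)" if "3 \<le> k" for k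
  proof -
    have "L k -` {i} \<inter> space M = {\<omega> \<in> space M. L k \<omega> = i}" by auto
    then show ?thesis
      using i choice_measurable[OF that] choices_prob[OF that i]
      by (simp add: emeasure_distr emeasure_eq_measure)
  qed
  then show "emeasure (distr M (count_space {1, 2, 3}) (L n)) {i}
      = emeasure (distr M (count_space {1, 2, 3}) (L 3)) {i}" using assms by simp
qed simp_all

lemma choice_function_measurable:
  fixes g :: "nat \<Rightarrow> real"
  assumes "3 \<le> n"
  shows "(\<lambda>\<omega>. g (L n \<omega>)) \<in> borel_measurable M"
  by (rule measurable_compose[OF choice_measurable[OF assms]]) simp

text \<open>
  Taking for \<open>g\<close> the increments of an index, or their squares, gives the numbers \<open>\<alpha>\<close> and \<open>\<beta>\<close> of the
  theorem.
\<close>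

lemma choice_function_expectation:
  fixes g :: "nat \<Rightarrow> real"
  assumes "3 \<le> n"
  shows "integrable M (\<lambda>\<omega>. g (L n \<omega>))"
    and "expectation (\<lambda>\<omega>. g (L n \<omega>)) = (\<Sum>i\<in>{1, 2, 3}. g i * p i)"
proof -
  let ?E = "\<lambda>i. {\<omega> \<in> space M. L n \<omega> = i}"
  have E: "?E i \<in> events" if "i \<in> {1, 2, 3}" for i
  proof -
    have "L n -` {i} \<inter> space M \<in> events"
      using choice_measurable[OF assms] by (rule measurable_sets) (use that in auto)
    then show ?thesis by (simp add: vimage_def Int_def conj_commute)
  qed
  have eq: "g (L n \<omega>) = (\<Sum>i\<in>{1, 2, 3}. g i * indicator (?E i) \<omega>)" if "\<omega> \<in> space M" for \<omega>
  proof -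
    have "L n \<omega> \<in> {1, 2, 3}"
      using measurable_space[OF choice_measurable[OF assms] that] by simp
    then show ?thesis using that by (auto simp: indicator_def)
  qed
  have int: "integrable M (\<lambda>\<omega>. g i * indicator (?E i) \<omega>)" if "i \<in> {1, 2, 3}" for i
    using E[OF that] by (intro integrable_mult_right) (simp add: less_top[symmetric])
  have "integrable M (\<lambda>\<omega>. \<Sum>i\<in>{1, 2, 3}. g i * indicator (?E i) \<omega>)"
    by (rule Bochner_Integration.integrable_sum) (rule int)
  then show "integrable M (\<lambda>\<omega>. g (L n \<omega>))"
    by (rule Bochner_Integration.integrable_cong[THEN iffD1, rotated -1]) (simp_all only: eq)
  have "expectation (\<lambda>\<omega>. g (L n \<omega>)) = expectation (\<lambda>\<omega>. \<Sum>i\<in>{1, 2, 3}. g i * indicator (?E i) \<omega>)"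
    by (rule Bochner_Integration.integral_cong) (simp_all only: eq)
  also have "\<dots> = (\<Sum>i\<in>{1, 2, 3}. expectation (\<lambda>\<omega>. g i * indicator (?E i) \<omega>))"
    by (rule Bochner_Integration.integral_sum) (rule int)
  also have "\<dots> = (\<Sum>i\<in>{1, 2, 3}. g i * p i)"
  proof (rule sum.cong[OF refl])
    fix i :: nat assume "i \<in> {1, 2, 3}"
    then show "expectation (\<lambda>\<omega>. g i * indicator (?E i) \<omega>) = g i * p i"
      using E choices_prob[OF assms] by simp
  qed
  finally show "expectation (\<lambda>\<omega>. g (L n \<omega>)) = (\<Sum>i\<in>{1, 2, 3}. g i * p i)" .
qed

text \<open>
  The first choice is made when the third hexagon is attached; the shift by 3 turns the choices into
  a sequence indexed by all natural numbers.
\<close>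

lemma choice_sums_clt:
  fixes g :: "nat \<Rightarrow> real"
  defines "m \<equiv> \<Sum>i\<in>{1, 2, 3}. g i * p i"
  defines "v \<equiv> (\<Sum>i\<in>{1, 2, 3}. (g i)\<^sup>2 * p i) - m\<^sup>2"
  assumes v: "0 < v"
  shows "weak_conv_m (\<lambda>n. distr M borel (\<lambda>\<omega>. (\<Sum>k<n. g (L (k + 3) \<omega>) - m) / sqrt (real n * v)))
     std_normal_distribution"
proof -
  have "indep_vars (\<lambda>_. count_space {1, 2, 3}) (\<lambda>k. L (k + 3)) UNIV"
  proof (rule indep_vars_reindex)
    have "range (\<lambda>k. k + 3) = {3::nat..}"
      by (auto simp: image_iff intro: exI[of _ "_ - 3"] le_add_diff_inverse2[symmetric])
    then show "indep_vars (\<lambda>_. count_space {1, 2, 3}) L (range (\<lambda>k. k + 3))"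
      using choices_indep by simp
  qed simp
  then have ind: "indep_vars (\<lambda>_. borel) (\<lambda>k \<omega>. g (L (k + 3) \<omega>)) UNIV"
    by (rule indep_vars_compose2) simp
  have sq: "integrable M (\<lambda>\<omega>. (g (L (k + 3) \<omega>))\<^sup>2)" for k
    by (rule choice_function_expectation(1)[where g = "\<lambda>i. (g i)\<^sup>2"]) simp
  have mean: "expectation (\<lambda>\<omega>. g (L (k + 3) \<omega>)) = m" for k
    unfolding m_def by (rule choice_function_expectation(2)) simp
  have var: "variance (\<lambda>\<omega>. g (L (k + 3) \<omega>)) = v" for k
  proof -
    have "expectation (\<lambda>\<omega>. (g (L (k + 3) \<omega>))\<^sup>2) = (\<Sum>i\<in>{1, 2, 3}. (g i)\<^sup>2 * p i)"
      by (rule choice_function_expectation(2)[where g = "\<lambda>i. (g i)\<^sup>2"]) simp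
    moreover have "integrable M (\<lambda>\<omega>. g (L (k + 3) \<omega>))"
      by (rule choice_function_expectation(1)) simp
    ultimately show ?thesis
      using mean sq by (subst variance_eq) (simp_all only: v_def)
  qed
  have dis: "distr M borel (\<lambda>\<omega>. g (L (k + 3) \<omega>)) = distr (distr M (count_space {1, 2, 3}) (L 3)) borel g" for k
  proof -
    have k: "3 \<le> k + 3" by simp
    show ?thesis
      unfolding choice_distr[OF k, symmetric]
      by (subst distr_distr) (simp_all only: choice_measurable[OF k] comp_def, simp)
  qed
  have "sqrt v > 0" "(sqrt v)\<^sup>2 = v" using v by simp_all
  then show ?thesis
    using central_limit_theorem[OF ind mean \<open>sqrt v > 0\<close> sq _ dis] var by simp
qed

end

section \<open>The central limit theorem for random spiro chains\<close>

theorem theorem2: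
  fixes M :: "'w measure"
    and p :: "nat \<Rightarrow> real"
    and L :: "nat \<Rightarrow> 'w \<Rightarrow> nat"
    and RSC :: "nat \<Rightarrow> 'w \<Rightarrow> 'v graph"
    and RSC2 :: "'v graph"
    and RSC3 :: "nat \<Rightarrow> 'v graph"
    and TI :: "'v graph \<Rightarrow> real"
    and a \<alpha> \<beta> :: real
    and \<alpha>' :: "nat \<Rightarrow> real"
  assumes "random_spiro_chain M p L RSC"
    and "topological_index a TI"
    and "spiro_chain [] RSC2"
    and "\<And>i. i \<in> {1, 2, 3} \<Longrightarrow> spiro_chain [i] (RSC3 i)"
    and "\<And>i. i \<in> {1, 2, 3} \<Longrightarrow> \<alpha>' i = TI (RSC3 i) - TI RSC2"
    and "\<alpha> = (\<Sum>i\<in>{1, 2, 3}. \<alpha>' i * p i)"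
    and "\<beta> = (\<Sum>i\<in>{1, 2, 3}. (\<alpha>' i)\<^sup>2 * p i)"
    and "\<beta> - \<alpha>\<^sup>2 > 0"
  shows "weak_conv_m
      (\<lambda>n. distr M borel (\<lambda>\<omega>. (TI (RSC n \<omega>) - (real n - 2) * \<alpha>) / sqrt (real n)))
      (density lborel (normal_density 0 (sqrt (\<beta> - \<alpha>\<^sup>2))))"
proof -
  interpret random_spiro_chain M p L RSC by fact
  obtain c :: real and \<delta> :: "nat \<Rightarrow> real"
    where TI: "\<And>ls G. spiro_chain ls G \<Longrightarrow> TI G = c + sum_list (map \<delta> ls)"
    using topological_index_spiro_chain[OF assms(2)] by blast
  have \<delta>: "\<alpha>' i = \<delta> i" if "i \<in> {1, 2, 3}" for i
    using TI[OF assms(3)] TI[OF assms(4)[OF that]] assms(5)[OF that] by simp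
  have mean: "(\<Sum>i\<in>{1, 2, 3}. \<delta> i * p i) = \<alpha>"
    unfolding assms(6) by (intro sum.cong) (simp_all add: \<delta>)
  have second: "(\<Sum>i\<in>{1, 2, 3}. (\<delta> i)\<^sup>2 * p i) = \<beta>"
    unfolding assms(7) by (intro sum.cong) (simp_all add: \<delta>)
  let ?v = "\<beta> - \<alpha>\<^sup>2"
  \<comment> \<open>\<open>Z n\<close> is the standardised sum of the first \<open>n\<close> increments, \<open>Y n\<close> the quantity of the theorem. A
    chain with \<open>n + 2\<close> hexagons involves \<open>n\<close> choices, so that \<open>Y (n + 2) = b n + s n * Z n\<close>.\<close>
  define Z where "Z n \<omega> = (\<Sum>k<n. \<delta> (L (k + 3) \<omega>) - \<alpha>) / sqrt (real n * ?v)" for n \<omega>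
  define Y where "Y n \<omega> = (TI (RSC n \<omega>) - (real n - 2) * \<alpha>) / sqrt (real n)" for n \<omega>
  define s where "s n = sqrt (real n * ?v) / sqrt (real (n + 2))" for n :: nat
  define b where "b n = c / sqrt (real (n + 2))" for n :: nat
  have Z: "random_variable borel (Z n)" for n
    unfolding Z_def by (intro borel_measurable_divide borel_measurable_sum borel_measurable_diff
        choice_function_measurable borel_measurable_const) simp
  have clt: "weak_conv_m (\<lambda>n. distr M borel (Z n)) std_normal_distribution"
    using choice_sums_clt[of \<delta>] assms(8) unfolding mean second Z_def by simp
  have "0 < sqrt ?v" using assms(8) by simp
  have "s \<longlonglongrightarrow> sqrt ?v"
  proof -
    have "(\<lambda>n. sqrt (real n / real (n + 2) * ?v)) \<longlonglongrightarrow> sqrt (1 * ?v)"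
      by (intro tendsto_intros) real_asymp
    then show ?thesis by (simp add: s_def[abs_def] real_sqrt_divide[symmetric])
  qed
  moreover have "b \<longlonglongrightarrow> 0" unfolding b_def[abs_def] by real_asymp
  ultimately have lim: "weak_conv_m (\<lambda>n. distr M borel (\<lambda>\<omega>. b n + s n * Z n \<omega>))
      (density lborel (normal_density 0 (sqrt ?v)))"
    unfolding distr_std_normal_affine[of "sqrt ?v" 0, OF \<open>0 < sqrt ?v\<close>, symmetric]
    using \<open>0 < sqrt ?v\<close>
    by (intro weak_conv_m_affine[OF Z real_dist_normal_dist measure_std_normal_singleton clt])
  have Y: "Y (n + 2) \<omega> = b n + s n * Z n \<omega>" if "\<omega> \<in> space M" for n \<omega>
  proof -
    have "Suc (n + 2) = n + 3" by simp
    then have idx: "[3..<Suc (n + 2)] = map (\<lambda>k. k + 3) [0..<n]"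
      by (simp only: map_add_upt)
    have "TI (RSC (n + 2) \<omega>) = c + sum_list (map \<delta> (map (\<lambda>k. L k \<omega>) [3..<Suc (n + 2)]))"
      by (rule TI[OF chain]) (use that in simp_all)
    also have "sum_list (map \<delta> (map (\<lambda>k. L k \<omega>) [3..<Suc (n + 2)])) = (\<Sum>k<n. \<delta> (L (k + 3) \<omega>))"
      unfolding idx by (simp add: comp_def interv_sum_list_conv_sum_set_nat atLeast0LessThan)
    finally have "TI (RSC (n + 2) \<omega>) - (real (n + 2) - 2) * \<alpha>
        = c + (\<Sum>k<n. \<delta> (L (k + 3) \<omega>) - \<alpha>)"
      by (simp add: sum_subtractf)
    moreover have "s n * Z n \<omega> = (\<Sum>k<n. \<delta> (L (k + 3) \<omega>) - \<alpha>) / sqrt (real (n + 2))"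
      \<comment> \<open>for \<open>n = 0\<close> the factor \<open>s n\<close> vanishes, and so does the empty sum\<close>
      using assms(8) by (cases "n = 0") (simp_all add: s_def Z_def)
    ultimately show ?thesis by (simp add: Y_def b_def add_divide_distrib)
  qed
  have "distr M borel (Y (n + 2)) = distr M borel (\<lambda>\<omega>. b n + s n * Z n \<omega>)" for n
    by (rule distr_cong) (simp_all only: Y)
  then have "weak_conv_m (\<lambda>n. distr M borel (Y (n + 2)))
      (density lborel (normal_density 0 (sqrt ?v)))"
    using lim by simp
  \<comment> \<open>The limit ignores \<open>Y 0\<close> and \<open>Y 1\<close>, which are not determined by choices.\<close>
  then have "weak_conv_m (\<lambda>n. distr M borel (Y n)) (density lborel (normal_density 0 (sqrt ?v)))"
    unfolding weak_conv_m_def weak_conv_def by (blast intro: LIMSEQ_offset[where k = 2])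
  then show ?thesis by (simp only: Y_def[abs_def])
qed

end
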